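(* The general Berwald's metric $$F(x,y)=\left\{1+\langle a,x\rangle+\frac{\langle a,y\rangle-|x|^2\langle a,y\rangle}{\sqrt{|y|^2-|x|^2|y|^2+\langle x,y\rangle^2}+\langle x,y\rangle}\right\}\frac{\left(\sqrt{|y|^2-|x|^2|y|^2+\langle x,y\rangle^2}+\langle x,y\rangle\right)^2}{(1-|x|^2)^2\sqrt{|y|^2-|x|^2|y|^2+\langle x,y\rangle^2}}$$ does not admit a (nonzero) parallel 1-form.
   Context: $|\cdot|$ and $\langle\cdot,\cdot\rangle$ are the standard Euclidean norm and inner product on $\mathbb{R}^n$, $n\ge2$; $x$ ranges over the open unit ball $\mathbb{B}^n$, $y\in T_x\mathbb{B}^n=\mathbb{R}^n$, and $a\in\mathbb{R}^n$ is a fixed vector for which $F$ is a Finsler metric on $\mathbb{B}^n$ (i.e. positive and smooth for $y\ne0$, positively 1-homogeneous in $y$, with $g_{ij}=\frac{\partial^2}{\partial y^i\partial y^j}(\tfrac12F^2)$ of rank $n$). The geodesic spray coefficients of $F$ are $G^i=\tfrac14 g^{il}\left(y^k\frac{\partial^2F^2}{\partial x^k\partial y^l}-\frac{\partial F^2}{\partial x^l}\right)$, and $G^h_{ij}=\frac{\partial^2G^h}{\partial y^i\partial y^j}$ are the Berwald connection coefficients. A 1-form $\beta=b_i(x)y^i$ is parallel if its Berwald horizontal covariant derivative vanishes: $b_{i|j}=\frac{\partial b_i}{\partial x^j}-G^h_{ij}b_h=0$ for all $x$ and all $y\neq0$. Parallel 1-forms are understood to be nonzero. *)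

theory Defs
  imports "HOL-Analysis.Analysis"
begin

primrec Ck_on :: "nat \<Rightarrow> 'a::real_normed_vector set \<Rightarrow> ('a \<Rightarrow> 'b::real_normed_vector) \<Rightarrow> bool" where
  "Ck_on 0 S f \<longleftrightarrow> continuous_on S f"
| "Ck_on (Suc k) S f \<longleftrightarrow> (\<forall>x\<in>S. f differentiable (at x)) \<and>
     (\<forall>v. Ck_on k S (\<lambda>x. frechet_derivative f (at x) v))"

text \<open>Only used for open \<open>S\<close>, since the derivatives are taken in the whole space.\<close>

definition smooth_on :: "'a::real_normed_vector set \<Rightarrow> ('a \<Rightarrow> 'b::real_normed_vector) \<Rightarrow> bool" where
  "smooth_on S f \<longleftrightarrow> (\<forall>k. Ck_on k S f)"

definition partial :: "'n::finite \<Rightarrow> (real^'n \<Rightarrow> real) \<Rightarrow> real^'n \<Rightarrow> real" where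
  "partial i f z = deriv (\<lambda>t. f (z + t *\<^sub>R axis i 1)) 0"

text \<open>A metric on an open set \<open>U\<close> is a function \<open>F x y\<close> of the point \<open>x\<close> and of the tangent
  vector \<open>y\<close> at \<open>x\<close>. Its values at \<open>y = 0\<close> and at \<open>x\<close> outside \<open>U\<close> are irrelevant.\<close>

definition fundamental_tensor ::
  "(real^'n::finite \<Rightarrow> real^'n \<Rightarrow> real) \<Rightarrow> real^'n \<Rightarrow> real^'n \<Rightarrow> real^'n^'n" where
  "fundamental_tensor F x y =
     (\<chi> i j. partial i (partial j (\<lambda>y. 1/2 * (F x y)\<^sup>2)) y)"

definition finsler_metric_on ::
  "(real^'n::finite) set \<Rightarrow> (real^'n \<Rightarrow> real^'n \<Rightarrow> real) \<Rightarrow> bool" where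
  "finsler_metric_on U F \<longleftrightarrow>
     (\<forall>x\<in>U. \<forall>y. y \<noteq> 0 \<longrightarrow> F x y > 0) \<and>
     smooth_on (U \<times> (UNIV - {0})) (\<lambda>(x, y). F x y) \<and>
     (\<forall>x\<in>U. \<forall>y. y \<noteq> 0 \<longrightarrow> (\<forall>c>0. F x (c *\<^sub>R y) = c * F x y)) \<and>
     (\<forall>x\<in>U. \<forall>y. y \<noteq> 0 \<longrightarrow> rank (fundamental_tensor F x y) = CARD('n))"

definition spray ::
  "(real^'n::finite \<Rightarrow> real^'n \<Rightarrow> real) \<Rightarrow> 'n \<Rightarrow> real^'n \<Rightarrow> real^'n \<Rightarrow> real" where
  "spray F i x y =
     1/4 * (\<Sum>l\<in>UNIV. matrix_inv (fundamental_tensor F x y) $ i $ l *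
       ((\<Sum>k\<in>UNIV. y $ k * partial k (\<lambda>x. partial l (\<lambda>y. (F x y)\<^sup>2) y) x)
        - partial l (\<lambda>x. (F x y)\<^sup>2) x))"

definition berwald_connection ::
  "(real^'n::finite \<Rightarrow> real^'n \<Rightarrow> real) \<Rightarrow> 'n \<Rightarrow> 'n \<Rightarrow> 'n \<Rightarrow> real^'n \<Rightarrow> real^'n \<Rightarrow> real" where
  "berwald_connection F h i j x y = partial i (partial j (spray F h x)) y"

text \<open>A 1-form is given by its component vector: \<open>b x $ i\<close> is the coefficient of the
  \<open>i\<close>-th coordinate differential at \<open>x\<close>.\<close>

definition horizontal_derivative ::
  "(real^'n::finite \<Rightarrow> real^'n \<Rightarrow> real) \<Rightarrow> (real^'n \<Rightarrow> real^'n) \<Rightarrow> 'n \<Rightarrow> 'n \<Rightarrow> real^'n \<Rightarrow> real^'n \<Rightarrow> real"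
  where
  "horizontal_derivative F b i j x y =
     partial j (\<lambda>x. b x $ i) x - (\<Sum>h\<in>UNIV. berwald_connection F h i j x y * b x $ h)"

definition parallel_one_form_on ::
  "(real^'n::finite) set \<Rightarrow> (real^'n \<Rightarrow> real^'n \<Rightarrow> real) \<Rightarrow> (real^'n \<Rightarrow> real^'n) \<Rightarrow> bool" where
  "parallel_one_form_on U F b \<longleftrightarrow> smooth_on U b \<and>
     (\<forall>x\<in>U. \<forall>y. y \<noteq> 0 \<longrightarrow> (\<forall>i j. horizontal_derivative F b i j x y = 0))"

definition general_berwald_metric ::
  "real^'n::finite \<Rightarrow> real^'n \<Rightarrow> real^'n \<Rightarrow> real" where
  "general_berwald_metric a x y =
     (let s = sqrt ((norm y)\<^sup>2 - (norm x)\<^sup>2 * (norm y)\<^sup>2 + (x \<bullet> y)\<^sup>2) in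
       (1 + a \<bullet> x + (a \<bullet> y - (norm x)\<^sup>2 * (a \<bullet> y)) / (s + x \<bullet> y)) *
       ((s + x \<bullet> y)\<^sup>2 / ((1 - (norm x)\<^sup>2)\<^sup>2 * s)))"

end

theory Submission
  imports Defs
begin

text \<open>
  Write \<open>\<langle>x, y\<rangle>\<close> for the inner product, \<open>w = 1 - |x|\<^sup>2\<close>, \<open>s\<close> for the square root in the metric, and
  \<open>\<Theta> = (s + \<langle>x, y\<rangle>) / w\<close> for the Funk metric of the unit ball, the positive solution of
  \<open>\<Theta> = |y + \<Theta> x|\<close>. With \<open>z = y + \<Theta> x\<close> the general Berwald metric is
  \<open>F = (|z| + \<langle>a, z\<rangle>) \<Theta> / s\<close>.

  It is projectively flat, and its spray is \<open>G\<^sup>i = \<Theta> y\<^sup>i\<close>. Writing \<open>\<partial>\<^sub>l\<close> for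
  \<open>\<partial>/\<partial>y\<^sup>l\<close>, Funk's equation \<open>\<partial>\<Theta>/\<partial>x\<^sup>l = \<Theta> \<partial>\<^sub>l \<Theta>\<close> entails
  \<open>\<partial>F/\<partial>x\<^sup>l = \<partial>\<^sub>l(\<Theta> F)\<close> (\<open>has_derivative_berwald_x\<close>). The derivative of \<open>\<partial>\<^sub>l F\<close> along the straight line
  \<open>t \<mapsto> x + t y\<close> is also \<open>\<partial>F/\<partial>x\<^sup>l\<close>, which is Hamel's equation (\<open>berwald_dy_along_line\<close>), while
  \<open>F\<close> itself grows at rate \<open>2 \<Theta> F\<close> (\<open>berwald_along_line\<close>). So the bracket in the definition of the
  spray equals \<open>4 \<Theta> F \<partial>\<^sub>l F\<close>. By Euler's theorem \<open>F \<partial>\<^sub>l F\<close> is the \<open>l\<close>-th entry of \<open>g y\<close>, where \<open>g\<close> is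
  the fundamental tensor, and inverting \<open>g\<close> leaves \<open>\<Theta> y\<close> (\<open>spray_general_berwald\<close>).

  Now let \<open>b\<close> be parallel and contract \<open>\<partial>b\<^sub>i/\<partial>x\<^sup>j = G\<^sup>h\<^sub>i\<^sub>j b\<^sub>h\<close> with \<open>y\<^sup>i y\<^sup>j\<close>. Since the spray is
  2-homogeneous, the right-hand side becomes \<open>2 \<Theta>(x, y) \<langle>b, y\<rangle>\<close>
  (\<open>berwald_connection_contraction\<close>), whereas the left-hand side is a quadratic form in \<open>y\<close>, hence
  even. As \<open>\<langle>b, y\<rangle>\<close> is odd, \<open>(\<Theta>(x, y) + \<Theta>(x, -y)) \<langle>b, y\<rangle> = 0\<close>. The Funk metric is positive, so
  \<open>\<langle>b, y\<rangle> = 0\<close> for every \<open>y\<close>, and \<open>b\<close> vanishes at \<open>x\<close>.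
\<close>

section \<open>Partial derivatives and Euler's theorem\<close>

lemma partial_eq:
  assumes "(f has_derivative f') (at z)"
  shows "partial i f z = f' (axis i 1)"
proof -
  have "((\<lambda>t::real. z + t *\<^sub>R axis i 1) has_derivative (\<lambda>t. t *\<^sub>R axis i 1)) (at 0)"
    by (auto intro!: derivative_eq_intros)
  from has_derivative_compose[OF this, of f f'] assms
  have "((\<lambda>t. f (z + t *\<^sub>R axis i 1)) has_derivative (\<lambda>t. f' (t *\<^sub>R axis i 1))) (at 0)"
    by simp
  moreover have "f' (t *\<^sub>R axis i 1) = f' (axis i 1) * t" for t
    using linear_scale[OF has_derivative_linear[OF assms]] by simp
  ultimately have "((\<lambda>t. f (z + t *\<^sub>R axis i 1)) has_real_derivative f' (axis i 1)) (at 0)"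
    by (simp add: has_field_derivative_def)
  then show ?thesis
    unfolding partial_def by (rule DERIV_imp_deriv)
qed

lemma sum_partial_eq:
  assumes "(f has_derivative f') (at z)"
  shows "(\<Sum>i\<in>UNIV. v $ i * partial i f z) = f' v"
proof -
  have lin: "linear f'" using assms by (rule has_derivative_linear)
  have "f' v = f' (\<Sum>i\<in>UNIV. v $ i *\<^sub>R axis i 1)"
    using basis_expansion[of v] by (simp add: scalar_mult_eq_scaleR)
  also have "\<dots> = (\<Sum>i\<in>UNIV. v $ i * f' (axis i 1))"
    by (simp add: linear_sum[OF lin] linear_scale[OF lin])
  finally show ?thesis using partial_eq[OF assms] by simp
qed

lemma euler_homogeneous2:
  fixes f :: "real^'n::finite \<Rightarrow> real"
  assumes "(f has_derivative f') (at y)"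
    and hom: "\<And>c. c > 0 \<Longrightarrow> f (c *\<^sub>R y) = c\<^sup>2 * f y"
  shows "f' y = 2 * f y"
proof -
  have "((\<lambda>c::real. c *\<^sub>R y) has_derivative (\<lambda>c. c *\<^sub>R y)) (at 1)"
    by (auto intro!: derivative_eq_intros)
  from has_derivative_compose[OF this, of f f'] assms
  have "((\<lambda>c. f (c *\<^sub>R y)) has_derivative (\<lambda>c. f' (c *\<^sub>R y))) (at 1)"
    by simp
  moreover have "f' (c *\<^sub>R y) = f' y * c" for c
    using linear_scale[OF has_derivative_linear[OF assms(1)]] by simp
  ultimately have d1: "((\<lambda>c. f (c *\<^sub>R y)) has_real_derivative f' y) (at 1)"
    by (simp add: has_field_derivative_def)
  have "((\<lambda>c. c\<^sup>2 * f y) has_real_derivative 2 * f y) (at 1)"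
    by (auto intro!: derivative_eq_intros)
  then have "((\<lambda>c. f (c *\<^sub>R y)) has_real_derivative 2 * f y) (at 1)"
    by (rule has_field_derivative_transform_within_open[where S="{0<..}"]) (auto simp: hom)
  with d1 show ?thesis by (rule DERIV_unique)
qed

text \<open>
  The first derivatives of a 2-homogeneous function are 1-homogeneous, so the Hessian sends \<open>y\<close> to
  the gradient at \<open>y\<close>. Here this comes from differentiating Euler's relation
  \<open>\<Sum>\<^sub>m y\<^sub>m \<partial>\<^sub>m f = 2 f\<close> in direction \<open>l\<close>, which produces \<open>\<partial>\<^sub>l \<partial>\<^sub>m f\<close> with the derivatives already in the
  order of the conclusion. It serves both for
  \<open>F\<^sup>2 / 2\<close> and for the spray coefficients.
\<close>

lemma hessian_times_radial:
  fixes f :: "real^'n::finite \<Rightarrow> real"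
  assumes der: "\<And>y. y \<noteq> 0 \<Longrightarrow> (f has_derivative f' y) (at y)"
    and diff: "\<And>v. (\<lambda>y. f' y v) differentiable (at y)"
    and hom: "\<And>y c. y \<noteq> 0 \<Longrightarrow> c > 0 \<Longrightarrow> f (c *\<^sub>R y) = c\<^sup>2 * f y"
    and y: "y \<noteq> 0"
  shows "(\<Sum>m\<in>UNIV. partial l (partial m f) y * y $ m) = partial l f y"
proof -
  have "\<exists>D. \<forall>m. (partial m f has_derivative D m) (at y)"
  proof (intro choice allI)
    fix m
    obtain D where "((\<lambda>y. f' y (axis m 1)) has_derivative D) (at y)"
      using diff by (auto simp: differentiable_def)
    then have "(partial m f has_derivative D) (at y)"
      by (rule has_derivative_transform_within_open[where s="- {0}"])
        (use y in \<open>auto simp: partial_eq[OF der]\<close>)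
    then show "\<exists>D. (partial m f has_derivative D) (at y)" by blast
  qed
  then obtain D where D: "\<And>m. (partial m f has_derivative D m) (at y)" by blast
  have eul: "(\<Sum>m\<in>UNIV. z $ m * partial m f z) = 2 * f z" if "z \<noteq> 0" for z
    using sum_partial_eq[OF der[OF that]] euler_homogeneous2[OF der[OF that] hom[OF that]] by simp
  have "((\<lambda>z. \<Sum>m\<in>UNIV. z $ m * partial m f z) has_derivative
      (\<lambda>h. \<Sum>m\<in>UNIV. y $ m * D m h + h $ m * partial m f y)) (at y)"
    by (intro has_derivative_sum has_derivative_mult D
        bounded_linear_imp_has_derivative bounded_linear_vec_nth)
  moreover have "((\<lambda>z. \<Sum>m\<in>UNIV. z $ m * partial m f z) has_derivative (\<lambda>h. 2 * f' y h)) (at y)"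
  proof (rule has_derivative_transform_within_open[where s="- {0}"])
    show "((\<lambda>z. 2 * f z) has_derivative (\<lambda>h. 2 * f' y h)) (at y)"
      by (intro has_derivative_mult_right der y)
  qed (use y eul in auto)
  ultimately have "(\<lambda>h. \<Sum>m\<in>UNIV. y $ m * D m h + h $ m * partial m f y) = (\<lambda>h. 2 * f' y h)"
    by (rule has_derivative_unique)
  then have "(\<Sum>m\<in>UNIV. y $ m * D m (axis l 1) + axis l 1 $ m * partial m f y) = 2 * f' y (axis l 1)"
    by meson
  moreover have "(\<Sum>m\<in>UNIV. axis l 1 $ m * partial m f y) = partial l f y"
    by (simp add: axis_def if_distrib[of "\<lambda>u. u * _"] cong: if_cong)
  ultimately show ?thesis
    by (simp add: partial_eq[OF D] partial_eq[OF der[OF y]] sum.distrib mult.commute)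
qed

section \<open>The Funk metric of the unit ball\<close>

definition root_term :: "real^'n::finite \<Rightarrow> real^'n \<Rightarrow> real" where
  "root_term x y = sqrt ((1 - x \<bullet> x) * (y \<bullet> y) + (x \<bullet> y)\<^sup>2)"

definition funk_metric :: "real^'n::finite \<Rightarrow> real^'n \<Rightarrow> real" where
  "funk_metric x y = (root_term x y + x \<bullet> y) / (1 - x \<bullet> x)"

lemma one_minus_inner_pos:
  fixes x :: "real^'n::finite"
  assumes "norm x < 1"
  shows "1 - x \<bullet> x > 0"
  using assms by (simp add: power2_norm_eq_inner[symmetric] abs_square_less_1)

lemma radicand_pos:
  fixes x y :: "real^'n::finite"
  assumes "norm x < 1" "y \<noteq> 0"
  shows "(1 - x \<bullet> x) * (y \<bullet> y) + (x \<bullet> y)\<^sup>2 > 0"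
  using one_minus_inner_pos[OF assms(1)] assms(2) by (intro add_pos_nonneg mult_pos_pos) auto

lemma root_term_pos: "norm x < 1 \<Longrightarrow> y \<noteq> 0 \<Longrightarrow> root_term x y > 0"
  using radicand_pos by (auto simp: root_term_def)

lemma root_term_sq:
  "norm x < 1 \<Longrightarrow> y \<noteq> 0 \<Longrightarrow> (root_term x y)\<^sup>2 = (1 - x \<bullet> x) * (y \<bullet> y) + (x \<bullet> y)\<^sup>2"
  using radicand_pos[of x y] by (simp add: root_term_def)

lemma root_term_eq: "norm x < 1 \<Longrightarrow> root_term x y = (1 - x \<bullet> x) * funk_metric x y - x \<bullet> y"
  using one_minus_inner_pos[of x] by (simp add: funk_metric_def)

lemma funk_metric_pos:
  assumes "norm x < 1" "y \<noteq> 0"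
  shows "funk_metric x y > 0"
proof -
  have "\<bar>x \<bullet> y\<bar> = sqrt ((x \<bullet> y)\<^sup>2)" by simp
  also have "\<dots> < root_term x y"
    unfolding root_term_def using one_minus_inner_pos[OF assms(1)] assms(2)
    by (intro real_sqrt_less_mono) simp
  finally show ?thesis
    unfolding funk_metric_def using one_minus_inner_pos[OF assms(1)]
    by (intro divide_pos_pos) linarith
qed

text \<open>
  This is \<open>\<Theta>\<^sup>2 = |y + \<Theta> x|\<^sup>2\<close> written out. Together with \<open>s = w \<Theta> - \<langle>x, y\<rangle>\<close> it turns every identity
  between \<open>s\<close> and \<open>\<Theta>\<close> below into polynomial algebra.
\<close>

lemma funk_metric_quadratic:
  assumes "norm x < 1" "y \<noteq> 0"
  shows "(1 - x \<bullet> x) * (funk_metric x y)\<^sup>2 = 2 * (x \<bullet> y) * funk_metric x y + y \<bullet> y"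
proof -
  have "((1 - x \<bullet> x) * funk_metric x y - x \<bullet> y)\<^sup>2 = (1 - x \<bullet> x) * (y \<bullet> y) + (x \<bullet> y)\<^sup>2"
    using root_term_sq[OF assms] root_term_eq[OF assms(1), of y] by simp
  then have "(1 - x \<bullet> x) * ((1 - x \<bullet> x) * (funk_metric x y)\<^sup>2)
      = (1 - x \<bullet> x) * (2 * (x \<bullet> y) * funk_metric x y + y \<bullet> y)"
    by (simp add: power2_eq_square algebra_simps)
  then show ?thesis using one_minus_inner_pos[OF assms(1)] by simp
qed

lemma root_term_scale: "c > 0 \<Longrightarrow> root_term x (c *\<^sub>R y) = c * root_term x y"
proof -
  assume "c > 0"
  have "(1 - x \<bullet> x) * ((c *\<^sub>R y) \<bullet> (c *\<^sub>R y)) + (x \<bullet> (c *\<^sub>R y))\<^sup>2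
      = c\<^sup>2 * ((1 - x \<bullet> x) * (y \<bullet> y) + (x \<bullet> y)\<^sup>2)"
    by (simp add: power2_eq_square algebra_simps)
  then show ?thesis using \<open>c > 0\<close> by (simp add: root_term_def real_sqrt_mult)
qed

lemma funk_metric_scale: "c > 0 \<Longrightarrow> funk_metric x (c *\<^sub>R y) = c * funk_metric x y"
  by (simp add: funk_metric_def root_term_scale distrib_left)

text \<open>
  The derivatives are stated along two moving arguments \<open>X p\<close> and \<open>Y p\<close>, so that one computation
  covers variation of the point, of the tangent vector, and of both.
\<close>

lemma has_derivative_root_term:
  fixes X Y :: "'a::real_normed_vector \<Rightarrow> real^'n::finite"
  assumes X: "(X has_derivative X') (at p)" and Y: "(Y has_derivative Y') (at p)"
    and p: "norm (X p) < 1" "Y p \<noteq> 0"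
  shows "((\<lambda>p. root_term (X p) (Y p)) has_derivative
    (\<lambda>h. ((1 - X p \<bullet> X p) * (Y p \<bullet> Y' h) - (X p \<bullet> X' h) * (Y p \<bullet> Y p)
        + (X p \<bullet> Y p) * (X p \<bullet> Y' h + X' h \<bullet> Y p)) / root_term (X p) (Y p))) (at p)"
  unfolding root_term_def
  using radicand_pos[OF p]
  by (auto intro!: derivative_eq_intros X Y ext simp: inner_commute[of "X' _"] inner_commute[of "Y' _"] field_simps)

text \<open>
  Differentiating \<open>\<Theta>\<^sup>2 = |z|\<^sup>2\<close> with \<open>z = Y + \<Theta> X\<close> gives
  \<open>(\<Theta> - \<langle>z, X\<rangle>) d\<Theta> = \<langle>z, dY + \<Theta> dX\<rangle>\<close>, and \<open>\<Theta> - \<langle>z, X\<rangle> = s\<close>. Varying \<open>X\<close> thus costs a factor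
  \<open>\<Theta>\<close> compared with varying \<open>Y\<close>: this is Funk's equation.
\<close>

lemma has_derivative_funk_metric:
  fixes X Y :: "'a::real_normed_vector \<Rightarrow> real^'n::finite"
  assumes X: "(X has_derivative X') (at p)" and Y: "(Y has_derivative Y') (at p)"
    and p: "norm (X p) < 1" "Y p \<noteq> 0"
  shows "((\<lambda>p. funk_metric (X p) (Y p)) has_derivative
    (\<lambda>h. ((Y p + funk_metric (X p) (Y p) *\<^sub>R X p) \<bullet> (Y' h + funk_metric (X p) (Y p) *\<^sub>R X' h))
        / root_term (X p) (Y p))) (at p)"
proof -
  let ?w = "1 - X p \<bullet> X p" and ?s = "root_term (X p) (Y p)" and ?T = "funk_metric (X p) (Y p)"
  let ?N = "\<lambda>h. (?w * (Y p \<bullet> Y' h) - (X p \<bullet> X' h) * (Y p \<bullet> Y p)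
        + (X p \<bullet> Y p) * (X p \<bullet> Y' h + X' h \<bullet> Y p)) / ?s"
  have w: "?w > 0" using one_minus_inner_pos p by blast
  have s: "?s > 0" using root_term_pos p by blast
  have seq: "?s = ?w * ?T - X p \<bullet> Y p" using root_term_eq p by blast
  have q: "?w * ?T\<^sup>2 = 2 * (X p \<bullet> Y p) * ?T + Y p \<bullet> Y p" using funk_metric_quadratic p by blast
  have "((\<lambda>p. funk_metric (X p) (Y p)) has_derivative
     (\<lambda>h. ((?N h + X p \<bullet> Y' h + X' h \<bullet> Y p) * ?w + (?s + X p \<bullet> Y p) * (2 * (X p \<bullet> X' h))) / (?w * ?w))) (at p)"
    unfolding funk_metric_def
    using w by (auto intro!: derivative_eq_intros has_derivative_root_term X Y p ext
        simp: inner_commute[of "X' _"] add.assoc)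
  moreover have "((?N h + X p \<bullet> Y' h + X' h \<bullet> Y p) * ?w + (?s + X p \<bullet> Y p) * (2 * (X p \<bullet> X' h))) / (?w * ?w)
     = ((Y p + ?T *\<^sub>R X p) \<bullet> (Y' h + ?T *\<^sub>R X' h)) / ?s" for h
  proof -
    have cancel: "(A * w + w * T * B) / (w * w) = (A + T * B) / w" if "w > 0" for A B T w :: real
      using that by (simp add: field_simps)
    have sp: "?s + X p \<bullet> Y p = ?w * ?T" using seq by simp
    have "((?N h + X p \<bullet> Y' h + X' h \<bullet> Y p) * ?w + (?s + X p \<bullet> Y p) * (2 * (X p \<bullet> X' h))) / (?w * ?w)
      = (?N h + X p \<bullet> Y' h + X' h \<bullet> Y p + ?T * (2 * (X p \<bullet> X' h))) / ?w"
      unfolding sp by (rule cancel[OF w])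
    moreover have "?N h * ?s = ?w * (Y p \<bullet> Y' h) - (X p \<bullet> X' h) * (Y p \<bullet> Y p)
        + (X p \<bullet> Y p) * (X p \<bullet> Y' h + X' h \<bullet> Y p)" using s by simp
    moreover have "?w * ((Y p + ?T *\<^sub>R X p) \<bullet> (Y' h + ?T *\<^sub>R X' h)) =
       ?w * (Y p \<bullet> Y' h) - (X p \<bullet> X' h) * (Y p \<bullet> Y p)
        + (X p \<bullet> Y p) * (X p \<bullet> Y' h + X' h \<bullet> Y p)
        + (X p \<bullet> Y' h + X' h \<bullet> Y p + ?T * (2 * (X p \<bullet> X' h))) * ?s"
    proof -
      have e: "(Y p + ?T *\<^sub>R X p) \<bullet> (Y' h + ?T *\<^sub>R X' h) =
        Y p \<bullet> Y' h + ?T * (X' h \<bullet> Y p) + ?T * (X p \<bullet> Y' h) + ?T\<^sup>2 * (X p \<bullet> X' h)"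
        by (simp add: inner_add_left inner_add_right power2_eq_square inner_commute[of "Y p" "X' h"] algebra_simps)
      show ?thesis unfolding e seq using q by algebra
    qed
    moreover have "(n + b + c + t) / w = Z / s"
      if "n * s = P" "w * Z = P + (b + c + t) * s" "w > 0" "s > 0" for n b c t w s Z P :: real
    proof -
      have "(n + b + c + t) * s = Z * w" using that(1,2) by (simp add: algebra_simps)
      then show ?thesis using that(3,4) by (simp add: frac_eq_eq)
    qed
    ultimately show ?thesis using w s by metis
  qed
  ultimately show ?thesis by simp
qed

section \<open>First derivatives of the Berwald metric\<close>

text \<open>
  The suffix \<open>dy\<close> marks a derivative in the tangent vector \<open>y\<close>, in the direction \<open>v\<close>. They are given by explicit
  formulas because they are differentiated again.
\<close>

definition funk_dy :: "real^'n::finite \<Rightarrow> real^'n \<Rightarrow> real^'n \<Rightarrow> real" where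
  "funk_dy x y v = ((y + funk_metric x y *\<^sub>R x) \<bullet> v) / root_term x y"

definition root_dy :: "real^'n::finite \<Rightarrow> real^'n \<Rightarrow> real^'n \<Rightarrow> real" where
  "root_dy x y v = ((1 - x \<bullet> x) * (y \<bullet> v) + (x \<bullet> y) * (x \<bullet> v)) / root_term x y"

text \<open>
  The Randers norm \<open>|z| + \<langle>a, z\<rangle>\<close> at \<open>z = y + \<Theta> x\<close>, where \<open>|z| = \<Theta>\<close>.
\<close>

definition randers :: "real^'n::finite \<Rightarrow> real^'n \<Rightarrow> real^'n \<Rightarrow> real" where
  "randers a x y = funk_metric x y * (1 + a \<bullet> x) + a \<bullet> y"

definition randers_dy :: "real^'n::finite \<Rightarrow> real^'n \<Rightarrow> real^'n \<Rightarrow> real^'n \<Rightarrow> real" where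
  "randers_dy a x y v = funk_dy x y v * (1 + a \<bullet> x) + a \<bullet> v"

definition berwald_dy :: "real^'n::finite \<Rightarrow> real^'n \<Rightarrow> real^'n \<Rightarrow> real^'n \<Rightarrow> real" where
  "berwald_dy a x y v =
     (randers_dy a x y v * funk_metric x y + randers a x y * funk_dy x y v) / root_term x y
     - randers a x y * funk_metric x y * root_dy x y v / (root_term x y)\<^sup>2"

lemma general_berwald_metric_eq:
  assumes "norm x < 1" "y \<noteq> 0"
  shows "general_berwald_metric a x y = randers a x y * funk_metric x y / root_term x y"
proof -
  have w: "1 - x \<bullet> x > 0" using one_minus_inner_pos assms by blast
  have s: "root_term x y > 0" using root_term_pos assms by blast
  have T: "funk_metric x y > 0" using funk_metric_pos assms by blast
  have sw: "root_term x y + x \<bullet> y = (1 - x \<bullet> x) * funk_metric x y"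
    using root_term_eq[OF assms(1), of y] by simp
  have r: "sqrt ((norm y)\<^sup>2 - (norm x)\<^sup>2 * (norm y)\<^sup>2 + (x \<bullet> y)\<^sup>2) = root_term x y"
    by (simp add: root_term_def power2_norm_eq_inner left_diff_distrib)
  have alg: "(1 + p + (q - u * q) / ((1 - u) * T)) * (((1 - u) * T)\<^sup>2 / ((1 - u)\<^sup>2 * s))
      = (T * (1 + p) + q) * T / s" if "1 - u > 0" "T > 0" "s > 0" for p q u T s :: real
  proof -
    have "(q - u * q) / ((1 - u) * T) = q / T" using that by (simp add: field_simps)
    moreover have "((1 - u) * T)\<^sup>2 / ((1 - u)\<^sup>2 * s) = T\<^sup>2 / s"
      using that by (simp add: power_mult_distrib)
    moreover have "(1 + p + q / T) * (T\<^sup>2 / s) = (T * (1 + p) + q) * T / s"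
      using that by (simp add: field_simps power2_eq_square)
    ultimately show ?thesis by simp
  qed
  show ?thesis
    unfolding general_berwald_metric_def r Let_def sw randers_def
    unfolding power2_norm_eq_inner
    by (rule alg[OF w T s])
qed

lemma has_derivative_root_term_y:
  assumes "norm x < 1" "y \<noteq> 0"
  shows "((\<lambda>y. root_term x y) has_derivative root_dy x y) (at y)"
  using has_derivative_root_term[OF has_derivative_const has_derivative_ident assms]
  unfolding root_dy_def by simp

lemma has_derivative_funk_metric_y:
  assumes "norm x < 1" "y \<noteq> 0"
  shows "((\<lambda>y. funk_metric x y) has_derivative funk_dy x y) (at y)"
  using has_derivative_funk_metric[OF has_derivative_const has_derivative_ident assms]
  unfolding funk_dy_def by simp

lemma has_derivative_root_term_x:
  assumes "norm x < 1" "y \<noteq> 0"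
  shows "((\<lambda>x. root_term x y) has_derivative
     (\<lambda>u. ((x \<bullet> y) * (u \<bullet> y) - (x \<bullet> u) * (y \<bullet> y)) / root_term x y)) (at x)"
  using has_derivative_root_term[OF has_derivative_ident has_derivative_const assms] by simp

lemma has_derivative_funk_metric_x:
  assumes "norm x < 1" "y \<noteq> 0"
  shows "((\<lambda>x. funk_metric x y) has_derivative (\<lambda>u. funk_metric x y * funk_dy x y u)) (at x)"
  using has_derivative_funk_metric[OF has_derivative_ident has_derivative_const assms]
  unfolding funk_dy_def by simp

text \<open>
  The right-hand side is the derivative of \<open>s\<close> in the point \<open>x\<close> with the opposite sign, and also the
  derivative of \<open>\<partial>\<^sub>v s\<close> along \<open>x + t y\<close>. Since \<open>1 / s\<close> is the only factor of \<open>F\<close> without a Funk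
  equation of its own, this identity is what makes both \<open>has_derivative_berwald_x\<close> and
  \<open>berwald_dy_along_line\<close> close.
\<close>

lemma root_dy_funk_dy:
  assumes "norm x < 1" "y \<noteq> 0"
  shows "root_term x y * funk_dy x y v - funk_metric x y * root_dy x y v
     = ((y \<bullet> y) * (x \<bullet> v) - (x \<bullet> y) * (y \<bullet> v)) / root_term x y"
proof -
  have s: "root_term x y > 0" using root_term_pos assms by blast
  have "root_term x y * ((y + funk_metric x y *\<^sub>R x) \<bullet> v)
      - funk_metric x y * ((1 - x \<bullet> x) * (y \<bullet> v) + (x \<bullet> y) * (x \<bullet> v))
     = (y \<bullet> y) * (x \<bullet> v) - (x \<bullet> y) * (y \<bullet> v)"
    unfolding root_term_eq[OF assms(1), of y] inner_add_left inner_scaleR_left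
    using funk_metric_quadratic[OF assms] by algebra
  then show ?thesis using s
    by (simp add: funk_dy_def root_dy_def field_simps)
qed

lemma has_derivative_berwald_y:
  assumes "norm x < 1" "y \<noteq> 0"
  shows "(general_berwald_metric a x has_derivative berwald_dy a x y) (at y)"
proof -
  have s: "root_term x y > 0" using root_term_pos assms by blast
  have "((\<lambda>y. randers a x y * funk_metric x y / root_term x y) has_derivative berwald_dy a x y) (at y)"
    using s unfolding randers_def berwald_dy_def randers_dy_def
    by (auto intro!: derivative_eq_intros has_derivative_root_term_y has_derivative_funk_metric_y
        assms ext simp: field_simps power2_eq_square)
  then show ?thesis
    by (rule has_derivative_transform_within_open[where s="- {0}"])
      (use assms in \<open>auto simp: general_berwald_metric_eq\<close>)
qed

text \<open>
  The equation \<open>\<partial>F/\<partial>x\<^sup>l = \<partial>\<^sub>l(\<Theta> F)\<close>. Both \<open>\<Theta> = |z|\<close> and the Randers norm at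
  \<open>z\<close> depend on \<open>x\<close> and \<open>y\<close> through \<open>z\<close> alone, and \<open>\<partial>z/\<partial>x\<^sup>l = \<Theta> \<partial>\<^sub>l z\<close>, so their
  derivatives in \<open>x\<close> are \<open>\<Theta>\<close> times those in \<open>y\<close>; the factor \<open>1 / s\<close> accounts for
  the extra term \<open>F \<partial>\<^sub>l \<Theta>\<close>.
\<close>

lemma has_derivative_berwald_x:
  assumes "norm x < 1" "y \<noteq> 0"
  shows "((\<lambda>x. general_berwald_metric a x y) has_derivative
    (\<lambda>u. funk_metric x y * berwald_dy a x y u + funk_dy x y u * general_berwald_metric a x y)) (at x)"
proof -
  let ?s = "root_term x y" and ?T = "funk_metric x y" and ?N = "randers a x y"
  have s: "?s > 0" using root_term_pos assms by blast
  let ?S = "\<lambda>u. ((x \<bullet> y) * (u \<bullet> y) - (x \<bullet> u) * (y \<bullet> y)) / ?s"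
  have N: "((\<lambda>x. randers a x y) has_derivative (\<lambda>u. ?T * randers_dy a x y u)) (at x)"
    unfolding randers_def randers_dy_def
    by (auto intro!: derivative_eq_intros has_derivative_funk_metric_x assms ext simp: algebra_simps)
  have "((\<lambda>x. randers a x y * funk_metric x y / root_term x y) has_derivative
    (\<lambda>u. (?T * randers_dy a x y u * ?T + ?N * (?T * funk_dy x y u)) / ?s - ?N * ?T * ?S u / ?s\<^sup>2)) (at x)"
    using s
    by (auto intro!: derivative_eq_intros has_derivative_root_term_x has_derivative_funk_metric_x N
        assms ext simp: field_simps power2_eq_square)
  also have "(\<lambda>u. (?T * randers_dy a x y u * ?T + ?N * (?T * funk_dy x y u)) / ?s - ?N * ?T * ?S u / ?s\<^sup>2)
    = (\<lambda>u. ?T * berwald_dy a x y u + funk_dy x y u * general_berwald_metric a x y)"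
  proof
    fix u
    have S: "?S u = - (?s * funk_dy x y u - ?T * root_dy x y u)"
      unfolding root_dy_funk_dy[OF assms] by (simp add: inner_commute field_simps diff_divide_distrib)
    show "(?T * randers_dy a x y u * ?T + ?N * (?T * funk_dy x y u)) / ?s - ?N * ?T * ?S u / ?s\<^sup>2
      = ?T * berwald_dy a x y u + funk_dy x y u * general_berwald_metric a x y"
      unfolding S general_berwald_metric_eq[OF assms] berwald_dy_def
      using s by (simp add: field_simps power2_eq_square)
  qed
  finally show ?thesis
    by (rule has_derivative_transform_within_open[where s="ball 0 1"])
      (use assms in \<open>auto simp: general_berwald_metric_eq\<close>)
qed

lemma differentiable_berwald_dy:
  fixes X Y :: "'a::real_normed_vector \<Rightarrow> real^'n::finite"
  assumes X: "X differentiable (at p)" and Y: "Y differentiable (at p)"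
    and p: "norm (X p) < 1" "Y p \<noteq> 0"
  shows "(\<lambda>p. funk_metric (X p) (Y p)) differentiable (at p)"
    and "(\<lambda>p. funk_dy (X p) (Y p) v) differentiable (at p)"
    and "(\<lambda>p. berwald_dy a (X p) (Y p) v) differentiable (at p)"
proof -
  have s: "root_term (X p) (Y p) \<noteq> 0" using root_term_pos p by fastforce
  obtain X' Y' where X': "(X has_derivative X') (at p)" and Y': "(Y has_derivative Y') (at p)"
    using X Y by (auto simp: differentiable_def)
  have inn: "(\<lambda>p. A p \<bullet> B p) differentiable (at p)"
    if AB: "A differentiable (at p)" "B differentiable (at p)" for A B :: "'a \<Rightarrow> real^'n"
  proof -
    obtain A' B' where "(A has_derivative A') (at p)" "(B has_derivative B') (at p)"
      using AB unfolding differentiable_def by blast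
    then show ?thesis unfolding differentiable_def by (blast intro: has_derivative_inner)
  qed
  have 1: "(\<lambda>p. root_term (X p) (Y p)) differentiable (at p)"
    using has_derivative_root_term[OF X' Y' p] by (auto simp: differentiable_def)
  show 2: "(\<lambda>p. funk_metric (X p) (Y p)) differentiable (at p)"
    using has_derivative_funk_metric[OF X' Y' p] by (auto simp: differentiable_def)
  show 3: "(\<lambda>p. funk_dy (X p) (Y p) v) differentiable (at p)"
    unfolding funk_dy_def by (intro derivative_intros inn X Y 1 2 s)
  show "(\<lambda>p. berwald_dy a (X p) (Y p) v) differentiable (at p)"
    unfolding berwald_dy_def root_dy_def randers_dy_def randers_def
    by (intro derivative_intros inn X Y 1 2 3 s) (use s in auto)
qed

section \<open>Straight lines and Hamel's equation\<close>

text \<open>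
  Moving the point along the straight line in direction \<open>y\<close> leaves \<open>s\<close> constant, because
  \<open>s\<^sup>2 = |y|\<^sup>2 - (|x|\<^sup>2 |y|\<^sup>2 - \<langle>x, y\<rangle>\<^sup>2)\<close> depends on \<open>x\<close> only through the squared area
  of the parallelogram spanned by \<open>x\<close> and \<open>y\<close>. Funk's equation in direction \<open>y\<close>, with \<open>\<partial>\<^sub>y \<Theta> = \<Theta>\<close> by homogeneity, gives \<open>\<Theta>\<^sup>2\<close>.
\<close>

lemma
  assumes "norm x < 1" "y \<noteq> 0"
  shows funk_metric_along_line:
      "((\<lambda>t. funk_metric (x + t *\<^sub>R y) y) has_real_derivative (funk_metric x y)\<^sup>2) (at 0)"
    and root_term_along_line:
      "((\<lambda>t. root_term (x + t *\<^sub>R y) y) has_real_derivative 0) (at 0)"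
proof -
  have s: "root_term x y > 0" using root_term_pos assms by blast
  have l: "((\<lambda>t. x + t *\<^sub>R y) has_derivative (\<lambda>t. t *\<^sub>R y)) (at 0)"
    by (auto intro!: derivative_eq_intros)
  have "funk_dy x y y = funk_metric x y"
  proof -
    have "(y + funk_metric x y *\<^sub>R x) \<bullet> y = funk_metric x y * root_term x y"
      unfolding root_term_eq[OF assms(1), of y] inner_add_left inner_scaleR_left
      using funk_metric_quadratic[OF assms] by algebra
    then show ?thesis using s by (simp add: funk_dy_def)
  qed
  then have "funk_metric x y * funk_dy x y (t *\<^sub>R y) = (funk_metric x y)\<^sup>2 * t" for t
  proof -
    have "funk_dy x y (t *\<^sub>R y) = t * funk_dy x y y" by (simp add: funk_dy_def)
    then show ?thesis using \<open>funk_dy x y y = funk_metric x y\<close> by (simp add: power2_eq_square)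
  qed
  moreover have "((\<lambda>t. funk_metric (x + t *\<^sub>R y) y) has_derivative
      (\<lambda>t. funk_metric x y * funk_dy x y (t *\<^sub>R y))) (at 0)"
    by (rule has_derivative_compose[OF l]) (use has_derivative_funk_metric_x[OF assms] in simp)
  ultimately show "((\<lambda>t. funk_metric (x + t *\<^sub>R y) y) has_real_derivative (funk_metric x y)\<^sup>2) (at 0)"
    by (simp add: has_field_derivative_def)
  have "(x \<bullet> y) * (t *\<^sub>R y \<bullet> y) - (x \<bullet> t *\<^sub>R y) * (y \<bullet> y) = 0" for t by simp
  moreover have "((\<lambda>t. root_term (x + t *\<^sub>R y) y) has_derivative
      (\<lambda>t. ((x \<bullet> y) * (t *\<^sub>R y \<bullet> y) - (x \<bullet> t *\<^sub>R y) * (y \<bullet> y)) / root_term x y)) (at 0)"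
    by (rule has_derivative_compose[OF l]) (use has_derivative_root_term_x[OF assms] in simp)
  ultimately show "((\<lambda>t. root_term (x + t *\<^sub>R y) y) has_real_derivative 0) (at 0)"
    by (simp add: has_field_derivative_def lambda_zero)
qed

lemma randers_along_line:
  assumes "norm x < 1" "y \<noteq> 0"
  shows "((\<lambda>t. randers a (x + t *\<^sub>R y) y) has_real_derivative funk_metric x y * randers a x y) (at 0)"
  unfolding randers_def
  by (auto intro!: derivative_eq_intros funk_metric_along_line assms
      simp: inner_add_right power2_eq_square algebra_simps)

lemma berwald_along_line:
  assumes "norm x < 1" "y \<noteq> 0"
  shows "((\<lambda>t. general_berwald_metric a (x + t *\<^sub>R y) y) has_real_derivative
    2 * funk_metric x y * general_berwald_metric a x y) (at 0)"
proof -
  have s: "root_term x y > 0" using root_term_pos assms by blast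
  let ?S = "(\<lambda>t. x + t *\<^sub>R y) -` ball 0 1"
  have "((\<lambda>t. randers a (x + t *\<^sub>R y) y * funk_metric (x + t *\<^sub>R y) y / root_term (x + t *\<^sub>R y) y)
      has_real_derivative 2 * funk_metric x y * general_berwald_metric a x y) (at 0)"
    unfolding general_berwald_metric_eq[OF assms]
    using s by (auto intro!: derivative_eq_intros randers_along_line funk_metric_along_line
        root_term_along_line assms simp: field_simps power2_eq_square)
  moreover have "open ?S"
    by (intro open_vimage continuous_intros) auto
  ultimately show ?thesis
    by (rule has_field_derivative_transform_within_open)
      (use assms in \<open>auto simp: general_berwald_metric_eq\<close>)
qed

text \<open>
  The value coincides with that of \<open>\<partial>F/\<partial>x\<close> in direction \<open>v\<close> from \<open>has_derivative_berwald_x\<close>: this is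
  Hamel's equation \<open>y\<^sup>k \<partial>\<^sup>2F/\<partial>x\<^sup>k\<partial>y\<^sup>l = \<partial>F/\<partial>x\<^sup>l\<close>, the criterion for straight geodesics.
\<close>

lemma berwald_dy_along_line:
  assumes "norm x < 1" "y \<noteq> 0"
  shows "((\<lambda>t. berwald_dy a (x + t *\<^sub>R y) y v) has_real_derivative
    (funk_metric x y * berwald_dy a x y v + funk_dy x y v * general_berwald_metric a x y)) (at 0)"
proof -
  let ?s = "root_term x y" and ?T = "funk_metric x y" and ?N = "randers a x y"
  have s: "?s > 0" using root_term_pos assms by blast
  note T = funk_metric_along_line[OF assms] and R = root_term_along_line[OF assms]
  have i: "((\<lambda>t. (c \<bullet> (x + t *\<^sub>R y))) has_real_derivative c \<bullet> y) (at 0)" for c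
    by (auto intro!: derivative_eq_intros simp: inner_add_right)
  have j: "((\<lambda>t. ((x + t *\<^sub>R y) \<bullet> c)) has_real_derivative y \<bullet> c) (at 0)" for c
    using i[of c] by (simp add: inner_commute)
  have w: "((\<lambda>t. (x + t *\<^sub>R y) \<bullet> (x + t *\<^sub>R y)) has_real_derivative 2 * (x \<bullet> y)) (at 0)"
    by (auto intro!: derivative_eq_intros simp: inner_add_right inner_add_left inner_commute)
  have N: "((\<lambda>t. randers a (x + t *\<^sub>R y) y) has_real_derivative ?T * ?N) (at 0)"
    using randers_along_line[OF assms] .
  have D: "((\<lambda>t. funk_dy (x + t *\<^sub>R y) y v) has_real_derivative ?T * funk_dy x y v) (at 0)"
    unfolding funk_dy_def inner_add_left[of y] inner_scaleR_left
    using s by (auto intro!: derivative_eq_intros T j R simp: field_simps power2_eq_square)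
  have ND: "((\<lambda>t. randers_dy a (x + t *\<^sub>R y) y v) has_real_derivative funk_dy x y v * ?N) (at 0)"
    unfolding randers_dy_def randers_def
    by (auto intro!: derivative_eq_intros D i simp: algebra_simps)
  have RD: "((\<lambda>t. root_dy (x + t *\<^sub>R y) y v) has_real_derivative
      ((y \<bullet> y) * (x \<bullet> v) - (x \<bullet> y) * (y \<bullet> v)) / ?s) (at 0)"
    unfolding root_dy_def
    using s by (auto intro!: derivative_eq_intros j R w simp: field_simps power2_eq_square)
  then have RD: "((\<lambda>t. root_dy (x + t *\<^sub>R y) y v) has_real_derivative
      ?s * funk_dy x y v - ?T * root_dy x y v) (at 0)"
    unfolding root_dy_funk_dy[OF assms] .
  show ?thesis
    unfolding berwald_dy_def general_berwald_metric_eq[OF assms]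
    using s by (auto intro!: derivative_eq_intros T R N D ND RD simp: field_simps power2_eq_square)
qed

section \<open>The spray and the parallel one-forms\<close>

text \<open>
  In the mixed term, \<open>y\<^sup>k \<partial>\<^sub>x\<^sub>k\<close> acts on \<open>2 F \<partial>\<^sub>l F\<close>: the growth rate \<open>2 \<Theta> F\<close> of \<open>F\<close> contributes
  \<open>4 \<Theta> F \<partial>\<^sub>l F\<close>, and by Hamel's equation the rest cancels against \<open>\<partial>F\<^sup>2/\<partial>x\<^sup>l\<close>. What remains is
  \<open>4 \<Theta>\<close> times \<open>g y\<close>.
\<close>

lemma spray_general_berwald:
  fixes a :: "real^'n::finite"
  assumes F: "finsler_metric_on (ball 0 1) (general_berwald_metric a)"
    and x: "norm x < 1" and y: "y \<noteq> 0"
  shows "spray (general_berwald_metric a) i x y = funk_metric x y * y $ i"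
proof -
  let ?F = "general_berwald_metric a" and ?T = "funk_metric x y"
  let ?B = "\<lambda>l. berwald_dy a x y (axis l 1)"
  define g where "g = fundamental_tensor ?F x y"
  have hom: "?F x (c *\<^sub>R z) = c * ?F x z" if "z \<noteq> 0" "c > 0" for c z
    using F x that by (auto simp: finsler_metric_on_def)
  have dF: "?F x differentiable (at z)" if "z \<noteq> 0" for z
    using has_derivative_berwald_y[OF x that] by (auto simp: differentiable_def)
  have dE: "((\<lambda>z. 1/2 * (?F x z)\<^sup>2) has_derivative (\<lambda>v. ?F x z * berwald_dy a x z v)) (at z)"
    if "z \<noteq> 0" for z
    by (auto intro!: derivative_eq_intros has_derivative_berwald_y x that)
  have gy: "(g *v y) $ l = ?F x y * ?B l" for l
  proof -
    have "(\<Sum>m\<in>UNIV. partial l (partial m (\<lambda>z. 1/2 * (?F x z)\<^sup>2)) y * y $ m)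
        = partial l (\<lambda>z. 1/2 * (?F x z)\<^sup>2) y"
    proof (rule hessian_times_radial[OF dE _ _ y])
      fix v
      show "(\<lambda>z. ?F x z * berwald_dy a x z v) differentiable (at y)"
        by (intro differentiable_mult differentiable_berwald_dy dF differentiable_const
            differentiable_ident x y)
    qed (auto simp: hom power_mult_distrib)
    also have "\<dots> = ?F x y * ?B l" by (rule partial_eq[OF dE[OF y]])
    finally show ?thesis
      by (simp add: g_def fundamental_tensor_def matrix_vector_mult_def)
  qed
  \<comment> \<open>The sum is a derivative in direction \<open>y\<close>, so it can be read off along the line \<open>x + t y\<close>.\<close>
  have mixed: "(\<Sum>k\<in>UNIV. y $ k * partial k (\<lambda>x. partial l (\<lambda>y. (?F x y)\<^sup>2) y) x)
      = 4 * ?T * ?F x y * ?B l + 2 * ?F x y * (?T * ?B l + funk_dy x y (axis l 1) * ?F x y)" for l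
  proof -
    let ?H = "\<lambda>x. 2 * ?F x y * berwald_dy a x y (axis l 1)"
    have "?H differentiable (at x)"
      by (intro differentiable_mult differentiable_berwald_dy differentiable_const differentiable_ident x y)
        (use has_derivative_berwald_x[OF x y] in \<open>auto simp: differentiable_def\<close>)
    then obtain H' where H': "(?H has_derivative H') (at x)" by (auto simp: differentiable_def)
    have "partial l (\<lambda>y. (?F u y)\<^sup>2) y = ?H u" if "norm u < 1" for u
    proof -
      have "((\<lambda>y. (?F u y)\<^sup>2) has_derivative (\<lambda>v. 2 * ?F u y * berwald_dy a u y v)) (at y)"
        by (auto intro!: derivative_eq_intros has_derivative_berwald_y that y)
      from partial_eq[OF this] show ?thesis .
    qed
    then have "((\<lambda>x. partial l (\<lambda>y. (?F x y)\<^sup>2) y) has_derivative H') (at x)"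
      by (intro has_derivative_transform_within_open[where s="ball 0 1", OF H']) (use x in auto)
    then have sum: "(\<Sum>k\<in>UNIV. y $ k * partial k (\<lambda>x. partial l (\<lambda>y. (?F x y)\<^sup>2) y) x) = H' y"
      by (rule sum_partial_eq)
    have "((\<lambda>t. x + t *\<^sub>R y) has_derivative (\<lambda>t. t *\<^sub>R y)) (at 0)"
      by (auto intro!: derivative_eq_intros)
    from has_derivative_compose[OF this, of ?H H'] H'
    have "((\<lambda>t. ?H (x + t *\<^sub>R y)) has_derivative (\<lambda>t. H' (t *\<^sub>R y))) (at 0)" by simp
    moreover have "H' (t *\<^sub>R y) = H' y * t" for t
      using linear_scale[OF has_derivative_linear[OF H']] by simp
    ultimately have "((\<lambda>t. ?H (x + t *\<^sub>R y)) has_real_derivative H' y) (at 0)"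
      by (simp add: has_field_derivative_def)
    moreover have "((\<lambda>t. ?H (x + t *\<^sub>R y)) has_real_derivative
        4 * ?T * ?F x y * ?B l + 2 * ?F x y * (?T * ?B l + funk_dy x y (axis l 1) * ?F x y)) (at 0)"
      by (auto intro!: derivative_eq_intros berwald_along_line berwald_dy_along_line x y simp: algebra_simps)
    ultimately show ?thesis unfolding sum by (rule DERIV_unique)
  qed
  have pure: "partial l (\<lambda>x. (?F x y)\<^sup>2) x
      = 2 * ?F x y * (?T * ?B l + funk_dy x y (axis l 1) * ?F x y)" for l
  proof -
    have "((\<lambda>x. (?F x y)\<^sup>2) has_derivative
       (\<lambda>u. 2 * ?F x y * (?T * berwald_dy a x y u + funk_dy x y u * ?F x y))) (at x)"
      by (auto intro!: derivative_eq_intros has_derivative_berwald_x x y)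
    from partial_eq[OF this] show ?thesis .
  qed
  have "inj ((*v) g)"
    using F x y by (simp add: finsler_metric_on_def g_def full_rank_injective)
  then have "invertible g"
    by (simp add: invertible_left_inverse matrix_left_invertible_injective)
  then have inv: "matrix_inv g ** g = mat 1"
    unfolding invertible_def matrix_inv_def by (rule someI2_ex) simp
  have "spray ?F i x y = ?T * (matrix_inv g *v (g *v y)) $ i"
    unfolding spray_def mixed pure
    by (simp add: matrix_vector_mult_def[of "matrix_inv g"] gy g_def[symmetric] sum_distrib_left algebra_simps)
  then show ?thesis by (simp add: matrix_vector_mul_assoc inv)
qed

text \<open>
  The spray coefficient \<open>\<Theta> y\<^sup>h\<close> is 2-homogeneous, so Euler's theorem applies to its first derivatives
  in degree one and then to itself in degree two, which gives the factor 2.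
\<close>

lemma berwald_connection_contraction:
  fixes a :: "real^'n::finite"
  assumes F: "finsler_metric_on (ball 0 1) (general_berwald_metric a)"
    and x: "norm x < 1" and y: "y \<noteq> 0"
  shows "(\<Sum>i\<in>UNIV. \<Sum>j\<in>UNIV. y $ i * y $ j * berwald_connection (general_berwald_metric a) h i j x y)
     = 2 * funk_metric x y * y $ h"
proof -
  let ?G = "spray (general_berwald_metric a) h x"
  have G: "?G z = funk_metric x z * z $ h" if "z \<noteq> 0" for z
    using spray_general_berwald[OF F x that] .
  let ?G' = "\<lambda>z v. funk_metric x z * v $ h + funk_dy x z v * z $ h"
  have dG: "(?G has_derivative ?G' z) (at z)" if "z \<noteq> 0" for z
  proof (rule has_derivative_transform_within_open[where s="- {0}"])
    show "((\<lambda>z. funk_metric x z * z $ h) has_derivative ?G' z) (at z)"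
      by (intro has_derivative_mult has_derivative_funk_metric_y x that
          bounded_linear_imp_has_derivative bounded_linear_vec_nth)
  qed (use that in \<open>auto simp: G\<close>)
  have hom: "?G (c *\<^sub>R z) = c\<^sup>2 * ?G z" if "z \<noteq> 0" "c > 0" for c z
    using that by (simp add: G funk_metric_scale power2_eq_square)
  have nth: "(\<lambda>z::real^'n. z $ h) differentiable (at y)"
    using bounded_linear_imp_has_derivative[OF bounded_linear_vec_nth] by (auto simp: differentiable_def)
  have "(\<Sum>j\<in>UNIV. partial i (partial j ?G) y * y $ j) = partial i ?G y" for i
    by (rule hessian_times_radial[OF dG _ hom y])
      (auto intro!: derivative_intros differentiable_berwald_dy nth x y)
  then have "(\<Sum>i\<in>UNIV. \<Sum>j\<in>UNIV. y $ i * y $ j * partial i (partial j ?G) y)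
      = (\<Sum>i\<in>UNIV. y $ i * partial i ?G y)"
    by (simp add: sum_distrib_left[symmetric] mult.assoc mult.commute[of "y $ _" "partial _ _ _"])
  also have "\<dots> = 2 * ?G y"
    using sum_partial_eq[OF dG[OF y]] euler_homogeneous2[OF dG[OF y] hom[OF y]] by simp
  finally show ?thesis unfolding berwald_connection_def G[OF y] by (simp add: mult.assoc)
qed

theorem theorem4p6:
  fixes a :: "real^'n::finite"
  assumes "CARD('n) \<ge> 2"
    and "finsler_metric_on (ball 0 1) (general_berwald_metric a)"
  shows "\<not> (\<exists>b. parallel_one_form_on (ball 0 1) (general_berwald_metric a) b \<and>
               (\<exists>x\<in>ball 0 1. b x \<noteq> 0))"
proof
  assume "\<exists>b. parallel_one_form_on (ball 0 1) (general_berwald_metric a) b \<and> (\<exists>x\<in>ball 0 1. b x \<noteq> 0)"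
  then obtain b x where par: "parallel_one_form_on (ball 0 1) (general_berwald_metric a) b"
    and x: "norm x < 1" and bx: "b x \<noteq> 0" by auto
  let ?F = "general_berwald_metric a"
  define Q where "Q y = (\<Sum>i\<in>UNIV. \<Sum>j\<in>UNIV. y $ i * y $ j * partial j (\<lambda>x. b x $ i) x)" for y :: "real^'n"
  have Q: "Q y = 2 * funk_metric x y * (y \<bullet> b x)" if y: "y \<noteq> 0" for y
  proof -
    have b: "partial j (\<lambda>x. b x $ i) x = (\<Sum>h\<in>UNIV. berwald_connection ?F h i j x y * b x $ h)" for i j
      using par x y by (simp add: parallel_one_form_on_def horizontal_derivative_def)
    have "Q y = (\<Sum>i\<in>UNIV. \<Sum>j\<in>UNIV. \<Sum>h\<in>UNIV. y $ i * y $ j * berwald_connection ?F h i j x y * b x $ h)"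
      unfolding Q_def b by (simp add: sum_distrib_left mult.assoc)
    also have "\<dots> = (\<Sum>i\<in>UNIV. \<Sum>h\<in>UNIV. \<Sum>j\<in>UNIV. y $ i * y $ j * berwald_connection ?F h i j x y * b x $ h)"
      by (intro sum.cong refl sum.swap)
    also have "\<dots> = (\<Sum>h\<in>UNIV. \<Sum>i\<in>UNIV. \<Sum>j\<in>UNIV. y $ i * y $ j * berwald_connection ?F h i j x y * b x $ h)"
      by (rule sum.swap)
    also have "\<dots> = (\<Sum>h\<in>UNIV. 2 * funk_metric x y * y $ h * b x $ h)"
      unfolding sum_distrib_right[symmetric]
      using berwald_connection_contraction[OF assms(2) x y] by simp
    also have "\<dots> = 2 * funk_metric x y * (y \<bullet> b x)"
      by (simp add: inner_vec_def sum_distrib_left mult.assoc)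
    finally show ?thesis .
  qed
  \<comment> \<open>The vector \<open>b x\<close> itself serves as \<open>y\<close>, so that \<open>\<langle>b, y\<rangle> > 0\<close>.\<close>
  have "Q (- b x) = Q (b x)" by (simp add: Q_def)
  then have "(funk_metric x (b x) + funk_metric x (- b x)) * (b x \<bullet> b x) = 0"
    using bx by (simp add: Q algebra_simps)
  moreover have "funk_metric x (b x) > 0" "funk_metric x (- b x) > 0"
    using funk_metric_pos[OF x] bx by auto
  ultimately show False using bx by simp
qed

end
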